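(* Let $(X,\pi)$ be a weighted $n$-partite simplicial complex, let $0\le\ell\le n$, and let $H$ be a labelled $k$-regular graph on the vertex set $\binom{[n]}{\ell}$. Let $\widetilde P_H$ be the expanderized up-down walk on $X^{(\ell)}$ via $H$ and $P_{\ell\leftrightarrow n}$ the (ordinary) up-down walk on $X^{(\ell)}$. Then $$\big\|\widetilde P_H-(1-\lambda(H))\,P_{\ell\leftrightarrow n}\big\|_{\mathrm{op},\pi_\ell}\le\lambda(H).$$
   Context: A pure simplicial complex of rank $n$ is a downward-closed family $X$ of subsets of a finite set all of whose inclusion-maximal members have size $n$; $X^{(j)}$ denotes its faces of size $j$. It is $n$-partite if $X^{(1)}$ is partitioned into sides $X[1],\dots,X[n]$ such that every $\omega\in X^{(n)}$ contains exactly one element of each side. $\mathrm{type}(\alpha)=\{i:\alpha\cap X[i]\neq\emptyset\}$; for $\omega\in X^{(n)}$, $S\subseteq[n]$, $\omega_S$ is the set of elements of $\omega$ in the sides indexed by $S$. $\pi$ is a full-support probability distribution on $X^{(n)}$, and $\pi_j(\alpha)=\binom{n}{j}^{-1}\Pr_{\omega\sim\pi}[\omega\supseteq\alpha]$ for $\alpha\in X^{(j)}$. Up-down walk: $P_{\ell\leftrightarrow n}(\hat\omega,\tilde\omega)=\binom{n}{\ell}^{-1}\Pr_{\omega\sim\pi}[\omega\supseteq\tilde\omega\mid\omega\supseteq\hat\omega]$ for $\hat\omega,\tilde\omega\in X^{(\ell)}$ (sample $\omega\sim\pi$ conditioned on containing $\hat\omega$, then output a uniformly random $\ell$-subset of $\omega$).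 A labelled $k$-regular graph $H$ on $V$ is given by maps $\mathrm{Out}_H(\cdot,a):V\to V$, $a\in[k]$, with symmetric walk matrix $A_H(S,T)=|\{a:\mathrm{Out}_H(S,a)=T\}|/k$; $\lambda(H)=\max\{\lambda_2(A_H),|\lambda_{\min}(A_H)|\}$ is its two-sided expansion. Expanderized up-down walk via $H$: $\widetilde P_H(\hat\omega,\tilde\omega)=A_H(\mathrm{type}(\hat\omega),\mathrm{type}(\tilde\omega))\cdot\Pr_{\omega\sim\pi}[\omega_{\mathrm{type}(\tilde\omega)}=\tilde\omega\mid\omega\supseteq\hat\omega]$. For a distribution $\mu$ with full support, $\|f\|_\mu^2=\sum_x\mu(x)f(x)^2$ and $\|A\|_{\mathrm{op},\mu}=\max_{f\neq0}\|Af\|_\mu/\|f\|_\mu$. *)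

theory Defs
  imports
    "HOL-Probability.Probability"
    "Jordan_Normal_Form.Char_Poly"
begin

section \<open>Weighted partite simplicial complexes\<close>

definition faces :: "'a set set \<Rightarrow> nat \<Rightarrow> 'a set set" where
  "faces X j = {\<alpha> \<in> X. card \<alpha> = j}"

definition pure_complex :: "nat \<Rightarrow> 'a set set \<Rightarrow> bool" where
  "pure_complex n X \<longleftrightarrow>
     finite (\<Union>X) \<and>
     (\<forall>\<alpha>\<in>X. \<forall>\<beta>. \<beta> \<subseteq> \<alpha> \<longrightarrow> \<beta> \<in> X) \<and>
     (\<forall>\<omega>\<in>X. (\<forall>\<alpha>\<in>X. \<omega> \<subseteq> \<alpha> \<longrightarrow> \<alpha> = \<omega>) \<longrightarrow> card \<omega> = n)"

text \<open>The sides are sets of vertices, a vertex \<open>v\<close> being identified with the face \<open>{v}\<close> of size 1.\<close>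

definition partite_complex :: "nat \<Rightarrow> 'a set set \<Rightarrow> (nat \<Rightarrow> 'a set) \<Rightarrow> bool" where
  "partite_complex n X side \<longleftrightarrow>
     pure_complex n X \<and>
     (\<Union>i\<in>{1..n}. side i) = {v. {v} \<in> X} \<and>
     disjoint_family_on side {1..n} \<and>
     (\<forall>\<omega>\<in>faces X n. \<forall>i\<in>{1..n}. \<exists>!v. v \<in> \<omega> \<and> v \<in> side i)"

definition weighted_partite_complex ::
  "nat \<Rightarrow> 'a set set \<Rightarrow> (nat \<Rightarrow> 'a set) \<Rightarrow> 'a set pmf \<Rightarrow> bool" where
  "weighted_partite_complex n X side \<pi> \<longleftrightarrow>
     partite_complex n X side \<and> set_pmf \<pi> = faces X n"

definition face_type :: "nat \<Rightarrow> (nat \<Rightarrow> 'a set) \<Rightarrow> 'a set \<Rightarrow> nat set" where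
  "face_type n side \<alpha> = {i \<in> {1..n}. \<alpha> \<inter> side i \<noteq> {}}"

definition face_restrict :: "(nat \<Rightarrow> 'a set) \<Rightarrow> 'a set \<Rightarrow> nat set \<Rightarrow> 'a set" where
  "face_restrict side \<omega> S = \<omega> \<inter> (\<Union>i\<in>S. side i)"

definition level_weight :: "nat \<Rightarrow> 'a set pmf \<Rightarrow> nat \<Rightarrow> 'a set \<Rightarrow> real" where
  "level_weight n \<pi> j \<alpha> = \<P>(\<omega> in measure_pmf \<pi>. \<alpha> \<subseteq> \<omega>) / real (n choose j)"


section \<open>Labelled regular graphs and their two-sided expansion\<close>

definition walk_matrix :: "nat \<Rightarrow> ('v \<Rightarrow> nat \<Rightarrow> 'v) \<Rightarrow> 'v \<Rightarrow> 'v \<Rightarrow> real" where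
  "walk_matrix k Out S T = real (card {a \<in> {1..k}. Out S a = T}) / real k"

definition labelled_regular_graph :: "'v set \<Rightarrow> nat \<Rightarrow> ('v \<Rightarrow> nat \<Rightarrow> 'v) \<Rightarrow> bool" where
  "labelled_regular_graph V k Out \<longleftrightarrow>
     finite V \<and> k \<ge> 1 \<and>
     (\<forall>S\<in>V. \<forall>a\<in>{1..k}. Out S a \<in> V) \<and>
     (\<forall>S\<in>V. \<forall>T\<in>V. walk_matrix k Out S T = walk_matrix k Out T S)"

text \<open>The eigenvalues of a \<open>V\<close>-indexed matrix in decreasing order, with multiplicity. The
  matrix is written out along the enumeration \<open>from_nat_into V\<close> of the finite set \<open>V\<close>; another
  enumeration gives a similar matrix, hence the same characteristic polynomial. For symmetric
  matrices all roots are real, so the list has length \<open>card V\<close>.\<close>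

definition eigenvalues_desc :: "'v set \<Rightarrow> ('v \<Rightarrow> 'v \<Rightarrow> real) \<Rightarrow> real list" where
  "eigenvalues_desc V A =
     rev (sorted_list_of_multiset (proots (char_poly
       (Matrix.mat (card V) (card V) (\<lambda>(i, j). A (from_nat_into V i) (from_nat_into V j))))))"

text \<open>If \<open>V\<close> is a singleton there is no second eigenvalue, and the maximum is taken over
  \<open>\<bar>\<lambda>\<^sub>m\<^sub>i\<^sub>n\<bar>\<close> alone.\<close>

definition two_sided_expansion :: "'v set \<Rightarrow> nat \<Rightarrow> ('v \<Rightarrow> nat \<Rightarrow> 'v) \<Rightarrow> real" where
  "two_sided_expansion V k Out =
     (let es = eigenvalues_desc V (walk_matrix k Out)
      in if card V = 1 then \<bar>last es\<bar> else max (es ! 1) \<bar>last es\<bar>)"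


section \<open>Up-down walks\<close>

definition updown_walk :: "nat \<Rightarrow> 'a set pmf \<Rightarrow> nat \<Rightarrow> 'a set \<Rightarrow> 'a set \<Rightarrow> real" where
  "updown_walk n \<pi> l \<alpha> \<beta> =
     \<P>(\<omega> in measure_pmf \<pi>. \<beta> \<subseteq> \<omega> \<bar> \<alpha> \<subseteq> \<omega>) / real (n choose l)"

definition expanderized_walk ::
  "nat \<Rightarrow> (nat \<Rightarrow> 'a set) \<Rightarrow> 'a set pmf \<Rightarrow> nat \<Rightarrow> (nat set \<Rightarrow> nat \<Rightarrow> nat set) \<Rightarrow>
   'a set \<Rightarrow> 'a set \<Rightarrow> real" where
  "expanderized_walk n side \<pi> k Out \<alpha> \<beta> =
     walk_matrix k Out (face_type n side \<alpha>) (face_type n side \<beta>) *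
     \<P>(\<omega> in measure_pmf \<pi>. face_restrict side \<omega> (face_type n side \<beta>) = \<beta> \<bar> \<alpha> \<subseteq> \<omega>)"


section \<open>Weighted operator norm\<close>

definition weighted_norm :: "'b set \<Rightarrow> ('b \<Rightarrow> real) \<Rightarrow> ('b \<Rightarrow> real) \<Rightarrow> real" where
  "weighted_norm \<Omega> \<mu> f = sqrt (\<Sum>x\<in>\<Omega>. \<mu> x * (f x)\<^sup>2)"

definition op_apply :: "'b set \<Rightarrow> ('b \<Rightarrow> 'b \<Rightarrow> real) \<Rightarrow> ('b \<Rightarrow> real) \<Rightarrow> 'b \<Rightarrow> real" where
  "op_apply \<Omega> A f x = (\<Sum>y\<in>\<Omega>. A x y * f y)"

text \<open>For finite \<open>\<Omega> \<noteq> {}\<close> and \<open>\<mu> > 0\<close> on \<open>\<Omega>\<close> the supremum is a maximum.\<close>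

definition weighted_op_norm :: "'b set \<Rightarrow> ('b \<Rightarrow> real) \<Rightarrow> ('b \<Rightarrow> 'b \<Rightarrow> real) \<Rightarrow> real" where
  "weighted_op_norm \<Omega> \<mu> A =
     Sup {weighted_norm \<Omega> \<mu> (op_apply \<Omega> A f) / weighted_norm \<Omega> \<mu> f | f. \<exists>x\<in>\<Omega>. f x \<noteq> 0}"

end

theory Submission
  imports Defs
begin

text \<open>
  Put \<open>\<rho> = \<lambda>(H)\<close> and \<open>B = A\<^sub>H - (1 - \<rho>) J\<close>, where \<open>J\<close> is the uniform averaging matrix on \<open>V\<close>.
  On constants \<open>B\<close> acts as \<open>\<rho>\<close>, and on their orthogonal complement as \<open>A\<^sub>H\<close>, so \<open>B\<close> has operator
  norm at most \<open>\<rho>\<close>. For a fixed top face \<open>\<omega>\<close>, the map \<open>face_type\<close> identifies the \<open>l\<close>-subsets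
  of \<open>\<omega>\<close> with \<open>V\<close>. The operator in question sends \<open>f\<close> to the conditional expectation, over
  \<open>\<omega> \<supseteq> \<alpha>\<close>, of \<open>B\<close> applied to \<open>f\<close> restricted to the \<open>l\<close>-subsets of \<open>\<omega>\<close>. By Jensen's inequality
  its norm is at most that of \<open>B\<close>.
\<close>

section \<open>Norm-attaining eigenvectors of symmetric matrices\<close>

text \<open>By compactness \<open>f \<mapsto> \<parallel>B f\<parallel>\<close> has a maximiser on
  the unit sphere, and self-adjointness turns it into an eigenvector. One eigenpair whose
  \<bar>\<mu>\<bar> bounds the operator norm is all that the later estimate uses; a full
  diagonalisation is avoided.\<close>

lemma symmetric_norm_attaining_eigenvector:
  fixes B :: "'v \<Rightarrow> 'v \<Rightarrow> real"
  assumes fin: "finite V" and ne: "V \<noteq> {}"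
    and sym: "\<And>x y. x \<in> V \<Longrightarrow> y \<in> V \<Longrightarrow> B x y = B y x"
  obtains \<mu> v where "\<exists>x\<in>V. v x \<noteq> 0"
    and "\<forall>x\<in>V. op_apply V B v x = \<mu> * v x"
    and "\<forall>f. (\<Sum>x\<in>V. (op_apply V B f x)\<^sup>2) \<le> \<mu>\<^sup>2 * (\<Sum>x\<in>V. (f x)\<^sup>2)"
proof -
  let ?T = "op_apply V B"
  \<comment> \<open>This is the unit sphere of \<open>V \<rightarrow> real\<close>, realised inside
    the full function space by functions vanishing off \<open>V\<close>. The bounds -1 and 1 are
    implied on the sphere; stating them exhibits it as a closed subset of a compact product.\<close>
  define S where "S = {f :: 'v \<Rightarrow> real. \<forall>x. f x \<in> (if x \<in> V then {-1..1} else {0})} \<inter> {f. (\<Sum>x\<in>V. (f x)\<^sup>2) = 1}"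
  have sq_cont: "continuous_on UNIV (\<lambda>f :: 'v \<Rightarrow> real. \<Sum>x\<in>V. (f x)\<^sup>2)"
    by (intro continuous_intros continuous_on_product_coordinates)
  have box: "compact {f :: 'v \<Rightarrow> real. \<forall>x. f x \<in> (if x \<in> V then {-1..1} else {0})}"
  proof -
    have "compactin (product_topology (\<lambda>_. euclidean) UNIV)
            (PiE UNIV (\<lambda>x. if x \<in> V then {-1..1::real} else {0}))"
      by (subst compactin_PiE) auto
    then show ?thesis
      by (simp add: euclidean_product_topology PiE_def Pi_def flip: compactin_euclidean_iff)
  qed
  have "closed {f :: 'v \<Rightarrow> real. (\<Sum>x\<in>V. (f x)\<^sup>2) = 1}"
    using continuous_closed_preimage_constant[OF sq_cont closed_UNIV, of 1] by simp
  then have "compact S"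
    unfolding S_def using box by (rule compact_Int_closed[rotated])
  moreover have "S \<noteq> {}"
  proof -
    obtain a where "a \<in> V" using ne by blast
    then have "(\<lambda>x. if x = a then 1 else 0) \<in> S"
      using fin by (auto simp: S_def if_distrib[of "\<lambda>t. t\<^sup>2"] cong: if_cong)
    then show ?thesis by blast
  qed
  moreover have "continuous_on S (\<lambda>f. \<Sum>x\<in>V. (?T f x)\<^sup>2)"
    unfolding op_apply_def
    by (intro continuous_intros continuous_on_subset[OF continuous_on_product_coordinates]) auto
  ultimately obtain g where g: "g \<in> S"
    and gmax: "\<And>f. f \<in> S \<Longrightarrow> (\<Sum>x\<in>V. (?T f x)\<^sup>2) \<le> (\<Sum>x\<in>V. (?T g x)\<^sup>2)"
    using continuous_attains_sup[of S "\<lambda>f. \<Sum>x\<in>V. (?T f x)\<^sup>2"] by blast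
  define M where "M = sqrt (\<Sum>x\<in>V. (?T g x)\<^sup>2)"
  have M2: "M\<^sup>2 = (\<Sum>x\<in>V. (?T g x)\<^sup>2)" by (simp add: M_def sum_nonneg)
  have g1: "(\<Sum>x\<in>V. (g x)\<^sup>2) = 1" using g by (simp add: S_def)
  have bound: "(\<Sum>x\<in>V. (?T f x)\<^sup>2) \<le> M\<^sup>2 * (\<Sum>x\<in>V. (f x)\<^sup>2)" for f
  proof (cases "\<forall>x\<in>V. f x = 0")
    case True
    then show ?thesis by (simp add: op_apply_def)
  next
    case False
    define r where "r = sqrt (\<Sum>x\<in>V. (f x)\<^sup>2)"
    have pos: "(\<Sum>x\<in>V. (f x)\<^sup>2) > 0"
      using False fin by (auto intro!: sum_pos2)
    then have r: "r > 0" and r2: "r\<^sup>2 = (\<Sum>x\<in>V. (f x)\<^sup>2)" by (auto simp: r_def)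
    define h where "h = (\<lambda>x. if x \<in> V then f x / r else 0)"
    have le: "\<bar>f x\<bar> \<le> r" if "x \<in> V" for x
      unfolding r_def using member_le_sum[of x V "\<lambda>x. (f x)\<^sup>2"] that fin
      by (intro real_le_rsqrt) auto
    have "(\<Sum>x\<in>V. (h x)\<^sup>2) = 1"
      using pos by (simp add: h_def power_divide r2 flip: sum_divide_distrib)
    moreover have "h x \<in> (if x \<in> V then {-1..1} else {0})" for x
      using le[of x] r by (auto simp: h_def field_simps abs_le_iff)
    ultimately have "h \<in> S" by (simp add: S_def)
    moreover have "?T h x = ?T f x / r" for x
      by (simp add: h_def op_apply_def sum_divide_distrib)
    ultimately have "(\<Sum>x\<in>V. (?T f x)\<^sup>2) / r\<^sup>2 \<le> M\<^sup>2"
      using gmax[of h] by (simp add: M2 power_divide sum_divide_distrib)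
    then show ?thesis using r by (simp add: field_simps flip: r2)
  qed
  have adj: "(\<Sum>x\<in>V. ?T a x * b x) = (\<Sum>x\<in>V. a x * ?T b x)" for a b
  proof -
    have "(\<Sum>x\<in>V. ?T a x * b x) = (\<Sum>x\<in>V. \<Sum>y\<in>V. a y * (B y x * b x))"
      unfolding op_apply_def sum_distrib_right by (intro sum.cong) (auto simp: sym)
    also have "\<dots> = (\<Sum>x\<in>V. a x * ?T b x)"
      unfolding op_apply_def sum_distrib_left by (rule sum.swap)
    finally show ?thesis .
  qed
  \<comment> \<open>A maximiser \<open>g\<close> satisfies \<open>T (T g) = M\<^sup>2 g\<close>: expand the square and use \<open>\<parallel>T (T g)\<parallel> \<le> M\<^sup>2\<close>.
    Factoring \<open>T\<^sup>2 - M\<^sup>2 = (T - M) (T + M)\<close> then gives an eigenvector.\<close>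
  have "(\<Sum>x\<in>V. (?T (?T g) x - M\<^sup>2 * g x)\<^sup>2) \<le> 0"
  proof -
    have "(\<Sum>x\<in>V. (?T (?T g) x - M\<^sup>2 * g x)\<^sup>2)
        = (\<Sum>x\<in>V. (?T (?T g) x)\<^sup>2) - 2 * M\<^sup>2 * (\<Sum>x\<in>V. ?T (?T g) x * g x) + M\<^sup>2 * M\<^sup>2 * (\<Sum>x\<in>V. (g x)\<^sup>2)"
      by (simp only: sum_distrib_left sum_subtractf[symmetric] sum.distrib[symmetric])
         (intro sum.cong, auto simp: power2_eq_square[of "_ - _"] power2_eq_square[of "g _"] power2_eq_square[of "op_apply _ _ _ _"] algebra_simps)
    also have "(\<Sum>x\<in>V. ?T (?T g) x * g x) = M\<^sup>2"
      using adj[of "?T g" g] by (simp only: M2) (simp add: power2_eq_square)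
    also have "(\<Sum>x\<in>V. (?T (?T g) x)\<^sup>2) \<le> M\<^sup>2 * M\<^sup>2"
      using bound[of "?T g"] by (simp add: M2)
    finally show ?thesis unfolding g1 by linarith
  qed
  then have "(\<Sum>x\<in>V. (?T (?T g) x - M\<^sup>2 * g x)\<^sup>2) = 0"
    by (intro antisym sum_nonneg) auto
  then have sq: "?T (?T g) x = M\<^sup>2 * g x" if "x \<in> V" for x
    using that fin by (auto simp: sum_nonneg_eq_0_iff)
  \<comment> \<open>\<open>h\<close> is an eigenvector for \<open>M\<close> unless it vanishes on
    \<open>V\<close>; in that case \<open>?T g = - M * g\<close> there, and \<open>g\<close> itself
    serves with eigenvalue \<open>- M\<close>.\<close>
  define h where "h = (\<lambda>x. ?T g x + M * g x)"
  show thesis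
  proof (cases "\<exists>x\<in>V. h x \<noteq> 0")
    case True
    have "?T h x = M * h x" if "x \<in> V" for x
    proof -
      have "?T h x = ?T (?T g) x + M * ?T g x"
        by (simp add: h_def op_apply_def[where f = "\<lambda>x. op_apply V B g x + M * g x"]
            op_apply_def[where f = "op_apply V B g"] distrib_left sum.distrib)
           (simp add: op_apply_def sum_distrib_left mult_ac)
      then show ?thesis using sq[OF that] by (simp add: h_def algebra_simps power2_eq_square)
    qed
    then show thesis using that[of h M] True bound by blast
  next
    case False
    then have "?T g x = - M * g x" if "x \<in> V" for x
      using that by (force simp: h_def)
    moreover have "\<exists>x\<in>V. g x \<noteq> 0" using g1 by (force intro: ccontr)
    ultimately show thesis using that[of g "- M"] bound by simp
  qed
qed

section \<open>Multiplicity and order of eigenvalues\<close>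

text \<open>The constants and \<open>v\<close> are two independent fixed vectors. As
  \<open>eigenvalues_desc\<close> counts roots of the characteristic polynomial, this has to be
  expressed as multiplicity of the root 1; it covers the case of a second eigenvalue equal to
  1.\<close>

lemma char_poly_double_root_one:
  fixes A :: "real mat"
  assumes A: "A \<in> carrier_mat m m"
    and row: "\<And>i. i < m \<Longrightarrow> (\<Sum>j<m. A $$ (i, j)) = 1"
    and fixed: "\<And>i. i < m \<Longrightarrow> (\<Sum>j<m. A $$ (i, j) * v j) = v i"
    and nonconst: "i1 < m" "v i1 \<noteq> v 0"
  shows "order 1 (char_poly A) \<ge> 2"
proof -
  have m: "0 < m" using nonconst by auto
  let ?C = "char_poly_matrix A"
  \<comment> \<open>Adding all columns of \<open>x I - A\<close> to the first one makes that column \<open>x - 1\<close> times the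
    all-ones vector; after extracting this factor, the determinant still vanishes at \<open>x = 1\<close>.\<close>
  define P :: "real poly mat" where "P = Matrix.mat m m (\<lambda>(i, j). if j = 0 \<or> i = j then 1 else 0)"
  define D :: "real poly mat" where
    "D = Matrix.mat m m (\<lambda>(i, j). if i = j then (if j = 0 then [:-1, 1:] else 1) else 0)"
  define N :: "real poly mat" where
    "N = Matrix.mat m m (\<lambda>(i, j). if j = 0 then 1 else ?C $$ (i, j))"
  have C: "?C \<in> carrier_mat m m" using A by simp
  have P: "P \<in> carrier_mat m m" and D: "D \<in> carrier_mat m m" and N: "N \<in> carrier_mat m m"
    by (auto simp: P_def D_def N_def)
  have Cij: "?C $$ (i, j) = (if i = j then [:0, 1:] else 0) - [:A $$ (i, j):]" if "i < m" "j < m" for i j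
    using that A by (auto simp: char_poly_matrix_def)
  have prod: "?C * P = N * D"
  proof (rule eq_matI)
    fix i j assume "i < dim_row (N * D)" "j < dim_col (N * D)"
    then have ij: "i < m" "j < m" by (auto simp: N_def D_def)
    have L: "(?C * P) $$ (i, j) = (\<Sum>l<m. ?C $$ (i, l) * (if j = 0 \<or> l = j then 1 else 0))"
      using ij C by (simp add: P_def scalar_prod_def lessThan_atLeast0)
    have R: "(N * D) $$ (i, j) = (if j = 0 then [:-1, 1:] else ?C $$ (i, j))"
    proof -
      have "(N * D) $$ (i, j) = (\<Sum>l<m. (if l = 0 then 1 else ?C $$ (i, l)) *
          (if l = j then (if j = 0 then [:-1, 1:] else 1) else 0))"
        using ij by (simp add: N_def D_def scalar_prod_def lessThan_atLeast0)
      also have "\<dots> = (\<Sum>l<m. if l = j then (if j = 0 then [:-1, 1:] else ?C $$ (i, l)) else 0)"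
        by (intro sum.cong) auto
      finally show ?thesis using ij by simp
    qed
    show "(?C * P) $$ (i, j) = (N * D) $$ (i, j)"
    proof (cases "j = 0")
      case True
      have "(\<Sum>l<m. ?C $$ (i, l)) = (\<Sum>l<m. (if i = l then [:0, 1:] else 0)) - (\<Sum>l<m. [:A $$ (i, l):])"
        using ij by (simp add: Cij sum_subtractf)
      also have "(\<Sum>l<m. [:A $$ (i, l):]) = [:\<Sum>l<m. A $$ (i, l):]"
        by (induction m) auto
      finally show ?thesis using L R True ij row[of i] m by (simp add: if_distrib cong: if_cong)
    next
      case False
      then show ?thesis using L R ij by (simp add: if_distrib cong: if_cong)
    qed
  qed (use C in \<open>auto simp: P_def D_def N_def\<close>)
  have detP: "Determinant.det P = 1"
    by (subst det_lower_triangular[OF _ P]) (auto simp: P_def prod_list_diag_prod)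
  have detD: "Determinant.det D = [:-1, 1:]"
  proof -
    have "Determinant.det D = (\<Prod>i<m. if i = 0 then [:-1, 1:] else 1)"
      by (subst det_lower_triangular[OF _ D])
         (auto simp: D_def prod_list_diag_prod lessThan_atLeast0 intro!: prod.cong)
    then show ?thesis using m by simp
  qed
  have cp: "char_poly A = Determinant.det N * [:-1, 1:]"
    using arg_cong[OF prod, of Determinant.det] det_mult[OF C P] det_mult[OF N D] detP detD
    by (simp add: char_poly_def)
  have "poly (Determinant.det N) 1 = 0"
  proof -
    let ?N1 = "Matrix.mat m m (\<lambda>(i, j). if j = 0 then 1 else (if i = j then 1 else 0) - A $$ (i, j))"
    have "poly (Determinant.det N) 1 = Determinant.det ?N1"
      by (rule poly_det_cong[OF _ N]) (auto simp: N_def Cij)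
    also have "\<dots> = 0"
    proof (subst det_0_iff_vec_prod_zero_field[of _ m])
      \<comment> \<open>Subtracting the constant \<open>v 0\<close> makes the first coordinate
        vanish, so the column of ones contributes nothing. The other columns are those of
        \<open>I - A\<close>, which annihilates both \<open>v\<close> and the constants.\<close>
      let ?u = "Matrix.vec m (\<lambda>i. v i - v 0)"
      have "?u \<noteq> 0\<^sub>v m"
        using nonconst by (metis index_vec index_zero_vec(1) right_minus_eq)
      moreover have "?N1 *\<^sub>v ?u = 0\<^sub>v m"
      proof (rule eq_vecI)
        fix i assume "i < dim_vec (0\<^sub>v m :: real Matrix.vec)"
        then have i: "i < m" by simp
        have "vec_index (?N1 *\<^sub>v ?u) i = (\<Sum>j<m. (if j = 0 then 1 else (if i = j then 1 else 0) - A $$ (i, j)) * (v j - v 0))"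
          using i by (simp add: scalar_prod_def lessThan_atLeast0)
        also have "\<dots> = (\<Sum>j<m. (if i = j then v j - v 0 else 0) - A $$ (i, j) * v j + A $$ (i, j) * v 0)"
          by (intro sum.cong) (auto simp: algebra_simps)
        also have "\<dots> = v i - v 0 - v i + v 0"
          using i fixed[OF i] row[OF i] by (simp add: sum.distrib sum_subtractf flip: sum_distrib_right)
        finally show "vec_index (?N1 *\<^sub>v ?u) i = vec_index (0\<^sub>v m) i" using i by simp
      qed auto
      ultimately show "\<exists>u. u \<in> carrier_vec m \<and> u \<noteq> 0\<^sub>v m \<and> ?N1 *\<^sub>v u = 0\<^sub>v m"
        by (intro exI[of _ ?u]) auto
    qed auto
    finally show ?thesis .
  qed
  then have "[:-1, 1:] dvd Determinant.det N" by (simp add: poly_eq_0_iff_dvd)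
  then have "[:-1, 1:] ^ 2 dvd char_poly A"
    unfolding cp power2_eq_square by (rule mult_dvd_mono) simp
  moreover have "char_poly A \<noteq> 0" using degree_monic_char_poly[OF A] by auto
  ultimately show ?thesis by (simp add: order_divides)
qed

text \<open>If the entry at index 1 were below \<mu>, so would be all later ones, and at most one
  element of \<open>M\<close> could be at least \<mu>. The multiset inclusion supplies two, also
  when \<open>a = b\<close>.\<close>

lemma second_of_desc_ge:
  fixes \<mu> :: "'b :: linorder"
  assumes sub: "{#a, b#} \<subseteq># M" and "\<mu> \<le> a" "\<mu> \<le> b"
  shows "\<mu> \<le> rev (sorted_list_of_multiset M) ! 1"
proof (rule ccontr)
  assume neg: "\<not> ?thesis"
  define es where "es = rev (sorted_list_of_multiset M)"
  have mset: "mset es = M" by (simp add: es_def)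
  have desc: "sorted (rev es)" by (simp add: es_def)
  have "size {#a, b#} \<le> size M" using sub by (rule size_mset_mono)
  then have "length es \<ge> 2" by (simp flip: mset)
  then obtain x y zs where es: "es = x # y # zs"
    by (metis Suc_le_length_iff numeral_2_eq_2)
  have "y < \<mu>" using neg es by (simp add: es_def)
  moreover have "\<forall>z\<in>set zs. z \<le> y" using desc by (auto simp: es sorted_append)
  ultimately have "filter_mset ((\<le>) \<mu>) (mset (y # zs)) = {#}"
    by (auto simp: filter_mset_eq_conv)
  then have "size (filter_mset ((\<le>) \<mu>) M) \<le> 1" by (simp add: es flip: mset)
  moreover have "filter_mset ((\<le>) \<mu>) {#a, b#} \<subseteq># filter_mset ((\<le>) \<mu>) M"
    using sub by (rule multiset_filter_mono)
  then have "size {#a, b#} \<le> size (filter_mset ((\<le>) \<mu>) M)"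
    using assms(2,3) by (auto dest: size_mset_mono)
  ultimately show False by simp
qed

lemma last_of_desc_le:
  fixes a :: "'b :: linorder"
  assumes "a \<in># M"
  shows "last (rev (sorted_list_of_multiset M)) \<le> a"
proof (cases "sorted_list_of_multiset M")
  case Nil
  then show ?thesis using assms by (metis set_sorted_list_of_multiset empty_iff list.set(1))
next
  case (Cons x xs)
  then have "a \<in> set (x # xs)" "sorted (x # xs)"
    using assms by (metis set_sorted_list_of_multiset, metis sorted_sorted_list_of_multiset)
  then show ?thesis by (auto simp: Cons)
qed

text \<open>Both 1, with the constant eigenvector, and \<mu> are roots of the characteristic
  polynomial. Since \<mu> \<le> 1, two roots counted with multiplicity are at least \<mu>, which
  bounds the second entry from below; the last entry is below every root.\<close>

lemma eigenvalues_desc_bounds_orthogonal_eigenvalue: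
  fixes A :: "'v \<Rightarrow> 'v \<Rightarrow> real"
  assumes fin: "finite V"
    and row: "\<And>x. x \<in> V \<Longrightarrow> (\<Sum>y\<in>V. A x y) = 1"
    and eig: "\<And>x. x \<in> V \<Longrightarrow> op_apply V A v x = \<mu> * v x"
    and orth: "(\<Sum>x\<in>V. v x) = 0" and nz: "\<exists>x\<in>V. v x \<noteq> 0" and le1: "\<mu> \<le> 1"
  shows "\<mu> \<le> eigenvalues_desc V A ! 1" and "last (eigenvalues_desc V A) \<le> \<mu>"
proof -
  define m where "m = card V"
  define e where "e = from_nat_into V"
  define Am where "Am = Matrix.mat m m (\<lambda>(i, j). A (e i) (e j))"
  have bij: "bij_betw e {..<m} V" unfolding e_def m_def by (rule bij_betw_from_nat_into_finite[OF fin])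
  have eV: "e i \<in> V" if "i < m" for i using bij that by (auto simp: bij_betw_def)
  have Am: "Am \<in> carrier_mat m m" by (simp add: Am_def)
  have re: "(\<Sum>j<m. h (e j)) = (\<Sum>y\<in>V. h y)" for h :: "'v \<Rightarrow> real"
    by (rule sum.reindex_bij_betw[OF bij])
  have ne: "m > 0" using nz fin by (auto simp: m_def card_gt_0_iff)
  have rowm: "(\<Sum>j<m. Am $$ (i, j)) = 1" if "i < m" for i
    using re[of "A (e i)"] row[OF eV[OF that]] that by (simp add: Am_def)
  have eigm: "(\<Sum>j<m. Am $$ (i, j) * v (e j)) = \<mu> * v (e i)" if "i < m" for i
    using re[of "\<lambda>y. A (e i) y * v y"] eig[OF eV[OF that]] that by (simp add: Am_def op_apply_def)
  have es: "eigenvalues_desc V A = rev (sorted_list_of_multiset (proots (char_poly Am)))"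
    by (simp add: eigenvalues_desc_def Am_def m_def e_def)
  have cp0: "char_poly Am \<noteq> 0" using degree_monic_char_poly[OF Am] by auto
  have root: "poly (char_poly Am) c = 0"
    if "i0 < m" "w i0 \<noteq> 0" "\<And>i. i < m \<Longrightarrow> (\<Sum>j<m. Am $$ (i, j) * w j) = c * w i" for c w i0
  proof -
    have "Matrix.vec m w \<noteq> 0\<^sub>v m" 
      using that(1,2) by (auto dest: arg_cong[of _ _ "\<lambda>u. vec_index u i0"])
    moreover have "Am *\<^sub>v Matrix.vec m w = c \<cdot>\<^sub>v Matrix.vec m w"
      by (rule eq_vecI) (use that(3) Am in \<open>auto simp: scalar_prod_def lessThan_atLeast0\<close>)
    ultimately have "eigenvector Am (Matrix.vec m w) c" using Am by (simp add: eigenvector_def)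
    then show ?thesis using eigenvalue_root_char_poly[OF Am] by (auto simp: eigenvalue_def)
  qed
  obtain x0 where x0: "x0 \<in> V" "v x0 \<noteq> 0" using nz by blast
  then obtain i0 where i0: "i0 < m" "e i0 = x0" using bij by (auto simp: bij_betw_def)
  have root\<mu>: "poly (char_poly Am) \<mu> = 0"
    by (rule root[of i0 "\<lambda>i. v (e i)"]) (use i0 x0 eigm in auto)
  have root1: "poly (char_poly Am) 1 = 0"
    by (rule root[of 0 "\<lambda>_. 1"]) (use ne rowm in auto)
  show "last (eigenvalues_desc V A) \<le> \<mu>"
    unfolding es by (rule last_of_desc_le) (use root\<mu> cp0 in simp)
  define M where "M = proots (char_poly Am)"
  have M: "1 \<in># M" "\<mu> \<in># M" using root\<mu> root1 cp0 by (simp_all add: M_def)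
  have "{#1, \<mu>#} \<subseteq># M"
  proof (cases "\<mu> = 1")
    case True
    \<comment> \<open>For \<mu> = 1 the inclusion demands multiplicity two. A constant
      \<open>v\<close> with sum 0 would be zero, so \<open>v\<close> is not constant and the double
      root lemma applies.\<close>
    have "\<exists>i1<m. v (e i1) \<noteq> v (e 0)"
    proof (rule ccontr)
      assume "\<not> ?thesis"
      then obtain c where const: "\<And>i. i < m \<Longrightarrow> v (e i) = c" by blast
      then have "real m * c = 0" using re[of v] orth by simp
      then show False using const[OF i0(1)] i0 x0 ne by simp
    qed
    then obtain i1 where "i1 < m" "v (e i1) \<noteq> v (e 0)" by blast
    then have "2 \<le> order 1 (char_poly Am)"
      using eigm True char_poly_double_root_one[OF Am rowm, of "\<lambda>i. v (e i)" i1] by simp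
    then have "2 \<le> count M 1" using cp0 by (simp add: M_def)
    then show ?thesis using True by (simp add: subseteq_mset_def)
  next
    case False
    then show ?thesis using M by (simp add: subseteq_mset_def)
  qed
  then show "\<mu> \<le> eigenvalues_desc V A ! 1"
    unfolding es M_def[symmetric] by (rule second_of_desc_ge) (use le1 in auto)
qed

section \<open>Spectral bound for the walk matrix\<close>

text \<open>At a point where \<bar>v\<bar> is maximal, the eigenvalue equation writes
  \<open>\<mu> * v a\<close> as a weighted average of values of modulus at most
  \<open>\<bar>v a\<bar>\<close>.\<close>

lemma stochastic_eigenvalue_le_1:
  fixes A :: "'v \<Rightarrow> 'v \<Rightarrow> real"
  assumes fin: "finite V"
    and nonneg: "\<And>x y. A x y \<ge> 0"
    and row: "\<And>x. x \<in> V \<Longrightarrow> (\<Sum>y\<in>V. A x y) = 1"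
    and eig: "\<And>x. x \<in> V \<Longrightarrow> op_apply V A v x = \<mu> * v x"
    and nz: "\<exists>x\<in>V. v x \<noteq> 0"
  shows "\<bar>\<mu>\<bar> \<le> 1"
proof -
  have "Max ((\<lambda>x. \<bar>v x\<bar>) ` V) \<in> (\<lambda>x. \<bar>v x\<bar>) ` V"
    using fin nz by (intro Max_in) auto
  then obtain a where a: "a \<in> V" "\<bar>v a\<bar> = Max ((\<lambda>x. \<bar>v x\<bar>) ` V)" by auto
  have amax: "\<bar>v x\<bar> \<le> \<bar>v a\<bar>" if "x \<in> V" for x
    unfolding a(2) using that fin by (intro Max_ge) auto
  have "\<bar>\<mu>\<bar> * \<bar>v a\<bar> = \<bar>\<Sum>y\<in>V. A a y * v y\<bar>"
    using eig[OF a(1)] by (simp add: op_apply_def abs_mult)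
  also have "\<dots> \<le> (\<Sum>y\<in>V. A a y * \<bar>v y\<bar>)"
    using nonneg by (intro order_trans[OF sum_abs]) (simp add: abs_mult)
  also have "\<dots> \<le> (\<Sum>y\<in>V. A a y * \<bar>v a\<bar>)"
    using amax nonneg by (intro sum_mono mult_left_mono) auto
  also have "\<dots> = \<bar>v a\<bar>" using row[OF a(1)] by (simp flip: sum_distrib_right)
  finally have "\<bar>\<mu>\<bar> * \<bar>v a\<bar> \<le> \<bar>v a\<bar>" .
  moreover have "\<bar>v a\<bar> > 0" using nz amax by force
  ultimately show ?thesis by simp
qed

lemma walk_matrix_row_sum:
  assumes "labelled_regular_graph V k Out" and "S \<in> V"
  shows "(\<Sum>T\<in>V. walk_matrix k Out S T) = 1"
proof -
  have k: "k \<ge> 1" and fin: "finite V" and out: "Out S ` {1..k} \<subseteq> V"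
    using assms by (auto simp: labelled_regular_graph_def)
  have "(\<Sum>T\<in>V. card {a \<in> {1..k}. Out S a = T}) = k"
    using sum.group[of "{1..k}" V "Out S" "\<lambda>_. 1::nat"] fin out by simp
  then have "(\<Sum>T\<in>V. real (card {a \<in> {1..k}. Out S a = T})) = real k"
    by (simp flip: of_nat_sum)
  then show ?thesis using k by (simp add: walk_matrix_def flip: sum_divide_distrib)
qed

lemma two_sided_expansion_nonneg: "two_sided_expansion V k Out \<ge> 0"
  by (auto simp: two_sided_expansion_def Let_def le_max_iff_disj)

text \<open>It suffices to bound the eigenvalue \<mu> of a norm-attaining eigenvector
  \<open>v\<close> of \<open>B\<close>. If the entries of \<open>v\<close> do not sum to 0, then
  \<mu> = \<rho>; otherwise \<open>v\<close> is an eigenvector of the walk matrix orthogonal to the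
  constants, and \<mu> lies between the last and the second eigenvalue.\<close>

lemma walk_matrix_minus_uniform_contracts:
  fixes V :: "'v set"
  assumes G: "labelled_regular_graph V k Out" and ne: "V \<noteq> {}"
  defines "\<rho> \<equiv> two_sided_expansion V k Out"
  defines "B \<equiv> \<lambda>S T. walk_matrix k Out S T - (1 - \<rho>) / real (card V)"
  shows "(\<Sum>x\<in>V. (op_apply V B f x)\<^sup>2) \<le> \<rho>\<^sup>2 * (\<Sum>x\<in>V. (f x)\<^sup>2)"
proof -
  let ?A = "walk_matrix k Out"
  have fin: "finite V" and Asym: "\<And>S T. S \<in> V \<Longrightarrow> T \<in> V \<Longrightarrow> ?A S T = ?A T S"
    using G by (auto simp: labelled_regular_graph_def)
  have row: "\<And>S. S \<in> V \<Longrightarrow> (\<Sum>T\<in>V. ?A S T) = 1"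
    using walk_matrix_row_sum[OF G] .
  have card0: "card V > 0" using fin ne by (simp add: card_gt_0_iff)
  have Bsym: "B x y = B y x" if "x \<in> V" "y \<in> V" for x y
    using Asym[OF that] by (simp add: B_def)
  obtain \<mu> v where nz: "\<exists>x\<in>V. v x \<noteq> 0"
    and eig: "\<forall>x\<in>V. op_apply V B v x = \<mu> * v x"
    and bound: "\<forall>f. (\<Sum>x\<in>V. (op_apply V B f x)\<^sup>2) \<le> \<mu>\<^sup>2 * (\<Sum>x\<in>V. (f x)\<^sup>2)"
    by (rule symmetric_norm_attaining_eigenvector[OF fin ne Bsym])
  have \<rho>0: "\<rho> \<ge> 0" by (simp add: \<rho>_def two_sided_expansion_nonneg)
  have "\<bar>\<mu>\<bar> \<le> \<rho>"
  proof (cases "(\<Sum>x\<in>V. v x) = 0")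
    case False
    \<comment> \<open>By symmetry the columns of the walk matrix also sum to 1, and 1 - (1 - \<rho>)
      = \<rho>. Summing the eigenvalue equation over \<open>V\<close> then gives \<mu> =
      \<rho>.\<close>
    have col: "(\<Sum>x\<in>V. B x y) = \<rho>" if "y \<in> V" for y
    proof -
      have "(\<Sum>x\<in>V. ?A x y) = (\<Sum>x\<in>V. ?A y x)" using that by (intro sum.cong Asym) auto
      then show ?thesis using that card0 by (simp add: B_def sum_subtractf row)
    qed
    have "\<mu> * (\<Sum>x\<in>V. v x) = (\<Sum>x\<in>V. \<Sum>y\<in>V. B x y * v y)"
      using eig by (simp add: sum_distrib_left op_apply_def)
    also have "\<dots> = (\<Sum>y\<in>V. (\<Sum>x\<in>V. B x y) * v y)"
      unfolding sum_distrib_right by (rule sum.swap)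
    also have "\<dots> = \<rho> * (\<Sum>x\<in>V. v x)" by (simp add: col sum_distrib_left)
    finally show ?thesis using False \<rho>0 by simp
  next
    case True
    have eigA: "op_apply V ?A v x = \<mu> * v x" if "x \<in> V" for x
    proof -
      have "op_apply V B v x = op_apply V ?A v x - (1 - \<rho>) / real (card V) * (\<Sum>y\<in>V. v y)"
        by (simp add: B_def op_apply_def left_diff_distrib sum_subtractf sum_distrib_left)
      then show ?thesis using eig that True by simp
    qed
    have "\<bar>\<mu>\<bar> \<le> 1"
      by (rule stochastic_eigenvalue_le_1[OF fin _ row eigA nz]) (simp_all add: walk_matrix_def)
    then have "\<mu> \<le> 1" by simp
    note es = eigenvalues_desc_bounds_orthogonal_eigenvalue[OF fin row eigA True nz this]
    \<comment> \<open>The singleton branch in the definition of the expansion cannot occur here: a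
      nonzero vector with sum 0 needs two vertices.\<close>
    have "card V \<noteq> 1"
    proof
      assume "card V = 1"
      then obtain a where "V = {a}" by (rule card_1_singletonE)
      then show False using True nz by simp
    qed
    then have "\<rho> = max (eigenvalues_desc V ?A ! 1) \<bar>last (eigenvalues_desc V ?A)\<bar>"
      by (simp add: \<rho>_def two_sided_expansion_def Let_def)
    then show ?thesis using es by linarith
  qed
  then have "\<mu>\<^sup>2 \<le> \<rho>\<^sup>2" using power_mono[of "\<bar>\<mu>\<bar>" \<rho> 2] by simp
  then have "\<mu>\<^sup>2 * (\<Sum>x\<in>V. (f x)\<^sup>2) \<le> \<rho>\<^sup>2 * (\<Sum>x\<in>V. (f x)\<^sup>2)"
    by (intro mult_right_mono sum_nonneg) auto
  then show ?thesis using spec[OF bound, of f] by linarith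
qed

section \<open>Averaging a contraction over top faces\<close>

text \<open>Jensen's inequality for the square, with weights whose total need not be 1.\<close>

lemma weighted_Cauchy_Schwarz_sum:
  fixes p h :: "'w \<Rightarrow> real"
  assumes "\<And>x. x \<in> A \<Longrightarrow> p x \<ge> 0"
  shows "(\<Sum>x\<in>A. p x * h x)\<^sup>2 \<le> (\<Sum>x\<in>A. p x) * (\<Sum>x\<in>A. p x * (h x)\<^sup>2)"
proof -
  have "(\<Sum>x\<in>A. sqrt (p x) * (sqrt (p x) * h x))\<^sup>2
      \<le> (\<Sum>x\<in>A. (sqrt (p x))\<^sup>2) * (\<Sum>x\<in>A. (sqrt (p x) * h x)\<^sup>2)"
    by (rule Cauchy_Schwarz_ineq_sum)
  then show ?thesis
    using assms by (simp add: power_mult_distrib flip: mult.assoc cong: sum.cong)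
qed

text \<open>Read \<open>F\<close> as top faces with weights \<open>p\<close>, \<open>L\<close> as
  the lower faces, \<open>R\<close> as containment and \<open>t\<close> as the type. Then
  \<open>K\<close> averages, over \<omega> related to \<alpha>, the action of \<open>B\<close>
  inside \<omega>. Cauchy-Schwarz moves the square inside the average, and exchanging the sums
  leaves the bound for \<open>B\<close> in each \<omega>.\<close>

lemma lifted_kernel_contracts:
  fixes p :: "'w \<Rightarrow> real" and B :: "'v \<Rightarrow> 'v \<Rightarrow> real" and t :: "'b \<Rightarrow> 'v"
    and R :: "'b \<Rightarrow> 'w \<Rightarrow> bool"
  assumes finF: "finite F" and finL: "finite L" and p0: "\<And>\<omega>. p \<omega> \<ge> 0"
    and bij: "\<And>\<omega>. \<omega> \<in> F \<Longrightarrow> bij_betw t {\<alpha> \<in> L. R \<alpha> \<omega>} V"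
    and contr: "\<And>h. (\<Sum>x\<in>V. (op_apply V B h x)\<^sup>2) \<le> c * (\<Sum>x\<in>V. (h x)\<^sup>2)"
    and w: "\<And>\<alpha>. \<alpha> \<in> L \<Longrightarrow> w \<alpha> = (\<Sum>\<omega> | \<omega> \<in> F \<and> R \<alpha> \<omega>. p \<omega>)"
    and K: "\<And>\<alpha> \<beta>. \<alpha> \<in> L \<Longrightarrow> \<beta> \<in> L \<Longrightarrow>
      K \<alpha> \<beta> = B (t \<alpha>) (t \<beta>) * ((\<Sum>\<omega> | \<omega> \<in> F \<and> R \<beta> \<omega> \<and> R \<alpha> \<omega>. p \<omega>) / w \<alpha>)"
  shows "(\<Sum>\<alpha>\<in>L. w \<alpha> * (op_apply L K f \<alpha>)\<^sup>2) \<le> c * (\<Sum>\<alpha>\<in>L. w \<alpha> * (f \<alpha>)\<^sup>2)"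
proof -
  \<comment> \<open>\<open>H \<omega>\<close> is \<open>B\<close> transported along \<open>t\<close>
    to the elements of \<open>L\<close> related to \<omega>, applied to \<open>f\<close>.\<close>
  define H where "H \<omega> \<alpha> = (\<Sum>\<beta> | \<beta> \<in> L \<and> R \<beta> \<omega>. B (t \<alpha>) (t \<beta>) * f \<beta>)" for \<omega> \<alpha>
  have local: "(\<Sum>\<alpha> | \<alpha> \<in> L \<and> R \<alpha> \<omega>. (H \<omega> \<alpha>)\<^sup>2) \<le> c * (\<Sum>\<alpha> | \<alpha> \<in> L \<and> R \<alpha> \<omega>. (f \<alpha>)\<^sup>2)"
    if "\<omega> \<in> F" for \<omega>
  proof -
    let ?L = "{\<alpha> \<in> L. R \<alpha> \<omega>}"
    define h where "h = (\<lambda>x. f (inv_into ?L t x))"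
    have re: "(\<Sum>\<alpha>\<in>?L. g (t \<alpha>)) = (\<Sum>x\<in>V. g x)" for g :: "'v \<Rightarrow> real"
      by (rule sum.reindex_bij_betw[OF bij[OF that]])
    have hf: "h (t \<alpha>) = f \<alpha>" if "\<alpha> \<in> ?L" for \<alpha>
      using bij_betw_inv_into_left[OF bij[OF \<open>\<omega> \<in> F\<close>] that] by (simp add: h_def)
    have "H \<omega> \<alpha> = op_apply V B h (t \<alpha>)" for \<alpha>
    proof -
      have "H \<omega> \<alpha> = (\<Sum>\<beta>\<in>?L. B (t \<alpha>) (t \<beta>) * h (t \<beta>))"
        unfolding H_def by (intro sum.cong) (auto simp: hf)
      then show ?thesis by (simp add: re[of "\<lambda>x. B (t \<alpha>) x * h x"] op_apply_def)
    qed
    then have "(\<Sum>\<alpha>\<in>?L. (H \<omega> \<alpha>)\<^sup>2) = (\<Sum>x\<in>V. (op_apply V B h x)\<^sup>2)"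
      using re[of "\<lambda>x. (op_apply V B h x)\<^sup>2"] by simp
    also have "\<dots> \<le> c * (\<Sum>x\<in>V. (h x)\<^sup>2)" by (rule contr)
    also have "(\<Sum>x\<in>V. (h x)\<^sup>2) = (\<Sum>\<alpha>\<in>?L. (h (t \<alpha>))\<^sup>2)"
      using re[of "\<lambda>x. (h x)\<^sup>2"] by simp
    also have "\<dots> = (\<Sum>\<alpha>\<in>?L. (f \<alpha>)\<^sup>2)" by (intro sum.cong) (auto simp: hf)
    finally show ?thesis .
  qed
  have jensen: "w \<alpha> * (op_apply L K f \<alpha>)\<^sup>2 \<le> (\<Sum>\<omega> | \<omega> \<in> F \<and> R \<alpha> \<omega>. p \<omega> * (H \<omega> \<alpha>)\<^sup>2)"
    if \<alpha>: "\<alpha> \<in> L" for \<alpha>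
  proof (cases "w \<alpha> = 0")
    \<comment> \<open>Here the left side is 0 whatever value the division by zero gives to
      \<open>K\<close>.\<close>
    case True
    then show ?thesis using p0 by (auto intro!: sum_nonneg)
  next
    case False
    have wpos: "w \<alpha> > 0" using False p0 w[OF \<alpha>] by (simp add: less_le sum_nonneg)
    \<comment> \<open>Multiplying by \<open>w \<alpha>\<close> clears the denominator in
      \<open>K\<close>; after the exchange of sums the inner one is
      \<open>H \<omega> \<alpha>\<close>.\<close>
    have "w \<alpha> * op_apply L K f \<alpha>
        = (\<Sum>\<beta>\<in>L. \<Sum>\<omega> | \<omega> \<in> {\<omega> \<in> F. R \<alpha> \<omega>} \<and> R \<beta> \<omega>. p \<omega> * (B (t \<alpha>) (t \<beta>) * f \<beta>))"
    proof -
      have "w \<alpha> * (K \<alpha> \<beta> * f \<beta>) = (\<Sum>\<omega> | \<omega> \<in> {\<omega> \<in> F. R \<alpha> \<omega>} \<and> R \<beta> \<omega>. p \<omega> * (B (t \<alpha>) (t \<beta>) * f \<beta>))"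
        if "\<beta> \<in> L" for \<beta>
      proof -
        have "{\<omega>. \<omega> \<in> {\<omega> \<in> F. R \<alpha> \<omega>} \<and> R \<beta> \<omega>} = {\<omega>. \<omega> \<in> F \<and> R \<beta> \<omega> \<and> R \<alpha> \<omega>}" by auto
        then show ?thesis using False K[OF \<alpha> that] by (simp flip: sum_distrib_right)
      qed
      then show ?thesis by (simp add: op_apply_def sum_distrib_left)
    qed
    also have "\<dots> = (\<Sum>\<omega> | \<omega> \<in> F \<and> R \<alpha> \<omega>. \<Sum>\<beta> | \<beta> \<in> L \<and> R \<beta> \<omega>. p \<omega> * (B (t \<alpha>) (t \<beta>) * f \<beta>))"
      by (rule sum.swap_restrict) (use finL finF in auto)
    also have "\<dots> = (\<Sum>\<omega> | \<omega> \<in> F \<and> R \<alpha> \<omega>. p \<omega> * H \<omega> \<alpha>)"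
      by (simp add: H_def sum_distrib_left)
    \<comment> \<open>The weights over \<omega> related to \<alpha> have total
      \<open>w \<alpha>\<close>, so Cauchy-Schwarz leaves one surplus factor on each side, cancelled
      next.\<close>
    finally have "(w \<alpha> * op_apply L K f \<alpha>)\<^sup>2 \<le> w \<alpha> * (\<Sum>\<omega> | \<omega> \<in> F \<and> R \<alpha> \<omega>. p \<omega> * (H \<omega> \<alpha>)\<^sup>2)"
      using weighted_Cauchy_Schwarz_sum[of "{\<omega> \<in> F. R \<alpha> \<omega>}" p "\<lambda>\<omega>. H \<omega> \<alpha>"] p0 by (simp add: w[OF \<alpha>])
    then have "w \<alpha> * (w \<alpha> * (op_apply L K f \<alpha>)\<^sup>2) \<le> w \<alpha> * (\<Sum>\<omega> | \<omega> \<in> F \<and> R \<alpha> \<omega>. p \<omega> * (H \<omega> \<alpha>)\<^sup>2)"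
      by (simp add: power_mult_distrib power2_eq_square mult_ac)
    then show ?thesis using wpos by simp
  qed
  have "(\<Sum>\<alpha>\<in>L. w \<alpha> * (op_apply L K f \<alpha>)\<^sup>2) \<le> (\<Sum>\<alpha>\<in>L. \<Sum>\<omega> | \<omega> \<in> F \<and> R \<alpha> \<omega>. p \<omega> * (H \<omega> \<alpha>)\<^sup>2)"
    by (rule sum_mono) (rule jensen)
  also have "\<dots> = (\<Sum>\<omega>\<in>F. \<Sum>\<alpha> | \<alpha> \<in> L \<and> R \<alpha> \<omega>. p \<omega> * (H \<omega> \<alpha>)\<^sup>2)"
    by (rule sum.swap_restrict[OF finL finF])
  also have "\<dots> \<le> (\<Sum>\<omega>\<in>F. p \<omega> * (c * (\<Sum>\<alpha> | \<alpha> \<in> L \<and> R \<alpha> \<omega>. (f \<alpha>)\<^sup>2)))"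
    unfolding sum_distrib_left[symmetric] by (intro sum_mono mult_left_mono local p0)
  also have "\<dots> = c * (\<Sum>\<omega>\<in>F. \<Sum>\<alpha> | \<alpha> \<in> L \<and> R \<alpha> \<omega>. p \<omega> * (f \<alpha>)\<^sup>2)"
    by (simp add: sum_distrib_left mult_ac)
  also have "(\<Sum>\<omega>\<in>F. \<Sum>\<alpha> | \<alpha> \<in> L \<and> R \<alpha> \<omega>. p \<omega> * (f \<alpha>)\<^sup>2) = (\<Sum>\<alpha>\<in>L. \<Sum>\<omega> | \<omega> \<in> F \<and> R \<alpha> \<omega>. p \<omega> * (f \<alpha>)\<^sup>2)"
    by (rule sum.swap_restrict[OF finL finF, symmetric])
  also have "\<dots> = (\<Sum>\<alpha>\<in>L. w \<alpha> * (f \<alpha>)\<^sup>2)"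
    by (simp add: w sum_distrib_right)
  finally show ?thesis .
qed

section \<open>Faces and types in partite complexes\<close>

lemma finite_complex: "pure_complex n X \<Longrightarrow> finite X"
  by (rule finite_subset[of _ "Pow (\<Union>X)"]) (auto simp: pure_complex_def)

lemma complex_subset_closed: "pure_complex n X \<Longrightarrow> \<alpha> \<in> X \<Longrightarrow> \<beta> \<subseteq> \<alpha> \<Longrightarrow> \<beta> \<in> X"
  by (auto simp: pure_complex_def)

text \<open>\<open>g i\<close> is the vertex of \<omega> in side \<open>i\<close>. It identifies
  subsets of \<omega> with index sets, so that type and restriction become the inverse image and the
  image under \<open>g\<close>.\<close>

lemma partite_face_transversal:
  assumes P: "partite_complex n X side" and \<omega>: "\<omega> \<in> faces X n"
  obtains g where "bij_betw g {1..n} \<omega>"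
    and "\<forall>S\<subseteq>{1..n}. face_type n side (g ` S) = S"
    and "\<forall>S\<subseteq>{1..n}. face_restrict side \<omega> S = g ` S"
proof -
  have ex1: "\<forall>i\<in>{1..n}. \<exists>!v. v \<in> \<omega> \<and> v \<in> side i"
    and disj: "disjoint_family_on side {1..n}"
    and cover: "(\<Union>i\<in>{1..n}. side i) = {v. {v} \<in> X}"
    and pure: "pure_complex n X"
    using P \<omega> by (auto simp: partite_complex_def)
  then obtain g where g: "\<forall>i\<in>{1..n}. g i \<in> \<omega> \<and> g i \<in> side i" by metis
  have iff: "g i \<in> side j \<longleftrightarrow> i = j" if "i \<in> {1..n}" "j \<in> {1..n}" for i j
    using g disj that unfolding disjoint_family_on_def by blast
  have "inj_on g {1..n}" using iff by (metis inj_onI)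
  moreover have "g ` {1..n} = \<omega>"
  proof (intro equalityI subsetI)
    \<comment> \<open>Downward closure makes \<open>{v}\<close> a face, so \<open>v\<close> lies in
      some side \<open>i\<close>, and uniqueness in that side gives \<open>v = g i\<close>.\<close>
    fix v assume v: "v \<in> \<omega>"
    then have "{v} \<in> X" using complex_subset_closed[OF pure, of \<omega> "{v}"] \<omega> by (auto simp: faces_def)
    then obtain i where "i \<in> {1..n}" "v \<in> side i" using cover by blast
    then have "v = g i" using ex1 g v by blast
    then show "v \<in> g ` {1..n}" using \<open>i \<in> {1..n}\<close> by blast
  qed (use g in auto)
  ultimately have bij: "bij_betw g {1..n} \<omega>" by (simp add: bij_betw_def)
  have "i \<in> face_type n side (g ` S) \<longleftrightarrow> i \<in> S" if S: "S \<subseteq> {1..n}" for S i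
  proof
    assume "i \<in> face_type n side (g ` S)"
    then obtain s where s: "s \<in> S" "i \<in> {1..n}" "g s \<in> side i" unfolding face_type_def by blast
    then have "s = i" using iff[of s i] S by blast
    then show "i \<in> S" using s by simp
  next
    assume i: "i \<in> S"
    then have "i \<in> {1..n}" using S by blast
    then show "i \<in> face_type n side (g ` S)" using iff[of i i] i unfolding face_type_def by blast
  qed
  then have type: "\<forall>S\<subseteq>{1..n}. face_type n side (g ` S) = S" by blast
  have "v \<in> face_restrict side \<omega> S \<longleftrightarrow> v \<in> g ` S" if S: "S \<subseteq> {1..n}" for S v
  proof
    assume "v \<in> face_restrict side \<omega> S"
    then obtain i j where "j \<in> S" "v \<in> side j" "i \<in> {1..n}" "v = g i"
      using \<open>g ` {1..n} = \<omega>\<close> unfolding face_restrict_def by blast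
    moreover from this have "i = j" using iff[of i j] S by blast
    ultimately show "v \<in> g ` S" by blast
  next
    assume "v \<in> g ` S"
    then obtain i where "i \<in> S" "v = g i" by blast
    then show "v \<in> face_restrict side \<omega> S" using g S unfolding face_restrict_def by blast
  qed
  then have "\<forall>S\<subseteq>{1..n}. face_restrict side \<omega> S = g ` S" by blast
  then show thesis using that bij type by blast
qed

lemma face_type_bij:
  assumes P: "partite_complex n X side" and \<omega>: "\<omega> \<in> faces X n"
  shows "bij_betw (face_type n side) {\<beta> \<in> faces X l. \<beta> \<subseteq> \<omega>} {S. S \<subseteq> {1..n} \<and> card S = l}"
proof -
  obtain g where bij: "bij_betw g {1..n} \<omega>"
    and tg: "\<forall>S\<subseteq>{1..n}. face_type n side (g ` S) = S"
    and rg: "\<forall>S\<subseteq>{1..n}. face_restrict side \<omega> S = g ` S"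
    by (rule partite_face_transversal[OF P \<omega>])
  have inj: "inj_on g {1..n}" and im: "g ` {1..n} = \<omega>" using bij by (auto simp: bij_betw_def)
  have card: "card (g ` S) = card S" if "S \<subseteq> {1..n}" for S
    using card_image[OF inj_on_subset[OF inj that]] .
  have surj: "\<exists>S\<subseteq>{1..n}. card S = l \<and> \<beta> = g ` S" if \<beta>: "\<beta> \<in> faces X l" "\<beta> \<subseteq> \<omega>" for \<beta>
  proof -
    obtain S where S: "S \<subseteq> {1..n}" "\<beta> = g ` S" using \<beta>(2) im by (metis subset_image_iff)
    moreover have "card S = l" using \<beta>(1) S card[OF S(1)] by (simp add: faces_def)
    ultimately show ?thesis by blast
  qed
  have mem: "g ` S \<in> faces X l \<and> g ` S \<subseteq> \<omega>" if "S \<subseteq> {1..n}" "card S = l" for S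
  proof -
    have sub: "g ` S \<subseteq> \<omega>" using im that(1) by blast
    have "pure_complex n X" "\<omega> \<in> X" using P \<omega> by (simp_all add: partite_complex_def faces_def)
    then have "g ` S \<in> X" using sub by (rule complex_subset_closed)
    then show ?thesis using sub card[OF that(1)] that(2) by (simp add: faces_def)
  qed
  show ?thesis
  proof (rule bij_betw_byWitness[where f' = "image g"])
    show "\<forall>\<beta>\<in>{\<beta> \<in> faces X l. \<beta> \<subseteq> \<omega>}. g ` face_type n side \<beta> = \<beta>"
    proof
      fix \<beta> assume "\<beta> \<in> {\<beta> \<in> faces X l. \<beta> \<subseteq> \<omega>}"
      then obtain S where "S \<subseteq> {1..n}" "\<beta> = g ` S" using surj by blast
      then show "g ` face_type n side \<beta> = \<beta>" using tg by simp
    qed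
    show "face_type n side ` {\<beta> \<in> faces X l. \<beta> \<subseteq> \<omega>} \<subseteq> {S. S \<subseteq> {1..n} \<and> card S = l}"
    proof
      fix T assume "T \<in> face_type n side ` {\<beta> \<in> faces X l. \<beta> \<subseteq> \<omega>}"
      then obtain S where "S \<subseteq> {1..n}" "card S = l" "T = face_type n side (g ` S)" using surj by blast
      then show "T \<in> {S. S \<subseteq> {1..n} \<and> card S = l}" using tg by simp
    qed
  qed (use tg mem in blast)+
qed

text \<open>On top faces the event in the expanderized walk is thus the containment event of the
  ordinary walk, so both walks carry the same conditional probability.\<close>

lemma face_restrict_type_eq_iff:
  assumes P: "partite_complex n X side" and \<omega>: "\<omega> \<in> faces X n"
  shows "face_restrict side \<omega> (face_type n side \<beta>) = \<beta> \<longleftrightarrow> \<beta> \<subseteq> \<omega>"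
proof
  assume "\<beta> \<subseteq> \<omega>"
  obtain g where bij: "bij_betw g {1..n} \<omega>"
    and tg: "\<forall>S\<subseteq>{1..n}. face_type n side (g ` S) = S"
    and rg: "\<forall>S\<subseteq>{1..n}. face_restrict side \<omega> S = g ` S"
    by (rule partite_face_transversal[OF P \<omega>])
  have im: "\<omega> = g ` {1..n}" using bij by (auto simp: bij_betw_def)
  obtain S where S: "S \<subseteq> {1..n}" "\<beta> = g ` S" using \<open>\<beta> \<subseteq> \<omega>\<close> im by (auto simp: subset_image_iff)
  then show "face_restrict side \<omega> (face_type n side \<beta>) = \<beta>" using tg rg by simp
qed (auto simp: face_restrict_def)

section \<open>Comparison of the two walks\<close>

lemma prob_pmf_sum:
  assumes "finite (set_pmf \<pi>)"
  shows "\<P>(\<omega> in measure_pmf \<pi>. Q \<omega>) = (\<Sum>\<omega> | \<omega> \<in> set_pmf \<pi> \<and> Q \<omega>. pmf \<pi> \<omega>)"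
proof -
  have "\<P>(\<omega> in measure_pmf \<pi>. Q \<omega>) = measure (measure_pmf \<pi>) ({\<omega>. Q \<omega>} \<inter> set_pmf \<pi>)"
    by (simp add: measure_Int_set_pmf)
  also have "{\<omega>. Q \<omega>} \<inter> set_pmf \<pi> = {\<omega> \<in> set_pmf \<pi>. Q \<omega>}" by auto
  finally show ?thesis using assms by (simp add: measure_measure_pmf_finite)
qed

theorem theorem3p5:
  fixes X :: "'a set set" and side :: "nat \<Rightarrow> 'a set" and \<pi> :: "'a set pmf"
    and n l k :: nat
    and V :: "nat set set" and Out :: "nat set \<Rightarrow> nat \<Rightarrow> nat set"
  defines "V \<equiv> {S. S \<subseteq> {1..n} \<and> card S = l}"
  assumes "weighted_partite_complex n X side \<pi>"
    and "l \<le> n"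
    and "labelled_regular_graph V k Out"
  shows "weighted_op_norm (faces X l) (level_weight n \<pi> l)
           (\<lambda>\<alpha> \<beta>. expanderized_walk n side \<pi> k Out \<alpha> \<beta>
                   - (1 - two_sided_expansion V k Out) * updown_walk n \<pi> l \<alpha> \<beta>)
         \<le> two_sided_expansion V k Out"
proof -
  define \<rho> where "\<rho> = two_sided_expansion V k Out"
  define B where "B = (\<lambda>S T. walk_matrix k Out S T - (1 - \<rho>) / real (card V))"
  define L where "L = faces X l"
  define F where "F = faces X n"
  \<comment> \<open>This is the level weight without its factor \<open>1 / (n choose l)\<close>,
    which is common to all faces and cancels in the norm inequality.\<close>
  define w where "w \<alpha> = (\<Sum>\<omega> | \<omega> \<in> F \<and> \<alpha> \<subseteq> \<omega>. pmf \<pi> \<omega>)" for \<alpha>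
  define K where "K = (\<lambda>\<alpha> \<beta>. expanderized_walk n side \<pi> k Out \<alpha> \<beta> - (1 - \<rho>) * updown_walk n \<pi> l \<alpha> \<beta>)"
  have P: "partite_complex n X side" and supp: "set_pmf \<pi> = F"
    using assms(2) by (auto simp: weighted_partite_complex_def F_def)
  then have pure: "pure_complex n X" by (simp add: partite_complex_def)
  have finF: "finite F" and finL: "finite L"
    using finite_complex[OF pure] by (auto simp: F_def L_def faces_def)
  have cardV: "card V = n choose l" using n_subsets[of "{1..n}" l] by (simp add: V_def)
  then have "card V > 0" using assms(3) by simp
  then have neV: "V \<noteq> {}" by auto
  have prob: "\<P>(\<omega> in measure_pmf \<pi>. Q \<omega>) = (\<Sum>\<omega> | \<omega> \<in> F \<and> Q \<omega>. pmf \<pi> \<omega>)" for Q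
    using prob_pmf_sum[of \<pi> Q] finF supp by simp
  have weight: "level_weight n \<pi> l \<alpha> = w \<alpha> / real (card V)" for \<alpha>
    by (simp only: level_weight_def prob w_def cardV)
  have restrict: "\<omega> \<in> F \<Longrightarrow> face_restrict side \<omega> (face_type n side \<beta>) = \<beta> \<longleftrightarrow> \<beta> \<subseteq> \<omega>" for \<omega> \<beta>
    using face_restrict_type_eq_iff[OF P] by (simp add: F_def)
  \<comment> \<open>The factor \<open>1 / (n choose l)\<close> of the ordinary walk equals
    \<open>1 / card V\<close>, the entry of the uniform averaging matrix. Taking out the common
    conditional probability leaves \<open>B\<close>.\<close>
  have K: "K \<alpha> \<beta> = B (face_type n side \<alpha>) (face_type n side \<beta>) *
      ((\<Sum>\<omega> | \<omega> \<in> F \<and> \<beta> \<subseteq> \<omega> \<and> \<alpha> \<subseteq> \<omega>. pmf \<pi> \<omega>) / w \<alpha>)" for \<alpha> \<beta>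
  proof -
    have "\<P>(\<omega> in measure_pmf \<pi>. \<beta> \<subseteq> \<omega> \<bar> \<alpha> \<subseteq> \<omega>) = (\<Sum>\<omega> | \<omega> \<in> F \<and> \<beta> \<subseteq> \<omega> \<and> \<alpha> \<subseteq> \<omega>. pmf \<pi> \<omega>) / w \<alpha>"
      by (simp only: cond_prob_def prob w_def)
    moreover have "\<P>(\<omega> in measure_pmf \<pi>. face_restrict side \<omega> (face_type n side \<beta>) = \<beta> \<bar> \<alpha> \<subseteq> \<omega>)
        = (\<Sum>\<omega> | \<omega> \<in> F \<and> \<beta> \<subseteq> \<omega> \<and> \<alpha> \<subseteq> \<omega>. pmf \<pi> \<omega>) / w \<alpha>"
      by (simp only: cond_prob_def prob w_def) (simp add: restrict cong: conj_cong)
    moreover have "a * q - (1 - \<rho>) * (q / real (card V)) = (a - (1 - \<rho>) / real (card V)) * q" for a q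
      by (simp add: left_diff_distrib)
    ultimately show ?thesis
      by (simp only: K_def expanderized_walk_def updown_walk_def B_def cardV[symmetric])
  qed
  have main: "(\<Sum>\<alpha>\<in>L. w \<alpha> * (op_apply L K f \<alpha>)\<^sup>2) \<le> \<rho>\<^sup>2 * (\<Sum>\<alpha>\<in>L. w \<alpha> * (f \<alpha>)\<^sup>2)" for f
  proof (rule lifted_kernel_contracts[where R = "(\<subseteq>)" and t = "face_type n side" and V = V and B = B])
    show "bij_betw (face_type n side) {\<alpha> \<in> L. \<alpha> \<subseteq> \<omega>} V" if "\<omega> \<in> F" for \<omega>
      using face_type_bij[OF P, of \<omega> l] that by (simp add: F_def L_def V_def)
    show "(\<Sum>x\<in>V. (op_apply V B h x)\<^sup>2) \<le> \<rho>\<^sup>2 * (\<Sum>x\<in>V. (h x)\<^sup>2)" for h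
      unfolding B_def \<rho>_def by (rule walk_matrix_minus_uniform_contracts[OF assms(4) neV])
  qed (use finF finL K w_def in auto)
  have \<rho>0: "\<rho> \<ge> 0" by (simp add: \<rho>_def two_sided_expansion_nonneg)
  have norm: "weighted_norm L (level_weight n \<pi> l) f = sqrt ((\<Sum>\<alpha>\<in>L. w \<alpha> * (f \<alpha>)\<^sup>2) / real (card V))" for f
    by (simp add: weighted_norm_def weight sum_divide_distrib)
  have bound: "weighted_norm L (level_weight n \<pi> l) (op_apply L K f) \<le> \<rho> * weighted_norm L (level_weight n \<pi> l) f" for f
  proof -
    have "sqrt ((\<Sum>\<alpha>\<in>L. w \<alpha> * (op_apply L K f \<alpha>)\<^sup>2) / real (card V))
        \<le> sqrt (\<rho>\<^sup>2 * ((\<Sum>\<alpha>\<in>L. w \<alpha> * (f \<alpha>)\<^sup>2) / real (card V)))"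
      using main[of f] by (simp add: divide_right_mono)
    also have "\<dots> = \<rho> * sqrt ((\<Sum>\<alpha>\<in>L. w \<alpha> * (f \<alpha>)\<^sup>2) / real (card V))"
      using \<rho>0 by (simp only: real_sqrt_mult real_sqrt_abs abs_of_nonneg)
    finally show ?thesis by (simp only: norm)
  qed
  \<comment> \<open>Bounding the supremum requires a nonempty set of quotients. The support of \<pi>
    supplies a top face, and the type bijection an \<open>l\<close>-face inside it.\<close>
  have "L \<noteq> {}"
  proof -
    obtain \<omega> where \<omega>: "\<omega> \<in> F" using supp set_pmf_not_empty[of \<pi>] by auto
    then have "{\<beta> \<in> L. \<beta> \<subseteq> \<omega>} \<noteq> {}"
      using face_type_bij[OF P, of \<omega> l] neV unfolding F_def L_def V_def bij_betw_def by blast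
    then show ?thesis by blast
  qed
  then obtain a where a: "a \<in> L" by blast
  have "weighted_op_norm L (level_weight n \<pi> l) K \<le> \<rho>"
    unfolding weighted_op_norm_def
  proof (rule cSup_least)
    show "{weighted_norm L (level_weight n \<pi> l) (op_apply L K f) / weighted_norm L (level_weight n \<pi> l) f
        | f. \<exists>x\<in>L. f x \<noteq> 0} \<noteq> {}"
      using a by (auto intro!: exI[of _ "\<lambda>_. 1"])
  next
    fix y assume "y \<in> {weighted_norm L (level_weight n \<pi> l) (op_apply L K f) / weighted_norm L (level_weight n \<pi> l) f
        | f. \<exists>x\<in>L. f x \<noteq> 0}"
    then obtain f where y: "y = weighted_norm L (level_weight n \<pi> l) (op_apply L K f) / weighted_norm L (level_weight n \<pi> l) f"
      by blast
    \<comment> \<open>A zero denominator makes the quotient 0 by convention, and \<rho> \<ge> 0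
      covers it; for a positive one the norm bound is divided through.\<close>
    have "weighted_norm L (level_weight n \<pi> l) f \<ge> 0"
      by (simp add: norm w_def sum_nonneg)
    then show "y \<le> \<rho>" using bound[of f] \<rho>0
      by (cases "weighted_norm L (level_weight n \<pi> l) f = 0") (auto simp: y field_simps)
  qed
  then show ?thesis by (simp only: K_def L_def \<rho>_def)
qed

end
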